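(* Every free quandle is residually finite. That is, for every non-empty set $S$, the free quandle $FQ(S)$ on $S$ is residually finite.
   Context: A quandle is a non-empty set $X$ with a binary operation $*$ such that: (1) $x*x=x$ for all $x\in X$; (2) for all $x,y\in X$ there is a unique $z\in X$ with $x=z*y$; (3) $(x*y)*z=(x*z)*(y*z)$ for all $x,y,z\in X$. A quandle homomorphism is a map $f$ with $f(x*y)=f(x)*f(y)$. A quandle $X$ is residually finite if for all $x,y\in X$ with $x\neq y$ there exist a finite quandle $F$ and a quandle homomorphism $\phi:X\to F$ with $\phi(x)\neq\phi(y)$. A free quandle on a non-empty set $S$ is a quandle $FQ(S)$ together with a map $\phi:S\to FQ(S)$ such that for every quandle $X$ and every map $\rho:S\to X$ there is a unique quandle homomorphism $\bar\rho:FQ(S)\to X$ with $\bar\rho\circ\phi=\rho$. It is unique up to isomorphism. *)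

theory Defs
  imports "HOL-Library.FuncSet" "HOL-Library.Equipollence"
begin

locale quandle =
  fixes X :: "'a set" and star :: "'a \<Rightarrow> 'a \<Rightarrow> 'a"
  assumes nonempty: "X \<noteq> {}"
    and closed: "\<lbrakk>x \<in> X; y \<in> X\<rbrakk> \<Longrightarrow> star x y \<in> X"
    and idem: "x \<in> X \<Longrightarrow> star x x = x"
    and unique_div: "\<lbrakk>x \<in> X; y \<in> X\<rbrakk> \<Longrightarrow> \<exists>!z. z \<in> X \<and> x = star z y"
    and self_distrib: "\<lbrakk>x \<in> X; y \<in> X; z \<in> X\<rbrakk>
      \<Longrightarrow> star (star x y) z = star (star x z) (star y z)"

definition quandle_hom ::
  "'a set \<Rightarrow> ('a \<Rightarrow> 'a \<Rightarrow> 'a) \<Rightarrow> 'b set \<Rightarrow> ('b \<Rightarrow> 'b \<Rightarrow> 'b) \<Rightarrow> ('a \<Rightarrow> 'b) set" where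
  "quandle_hom X f Y g =
    {\<phi>. \<phi> \<in> X \<rightarrow> Y \<and> (\<forall>x\<in>X. \<forall>y\<in>X. \<phi> (f x y) = g (\<phi> x) (\<phi> y))}"

text \<open>
  Every finite quandle is isomorphic to one whose elements are natural numbers, so letting the
  finite target range over quandles in \<^typ>\<open>nat\<close> is no restriction
  (see \<open>residually_finiteI\<close>).
\<close>

definition residually_finite :: "'a set \<Rightarrow> ('a \<Rightarrow> 'a \<Rightarrow> 'a) \<Rightarrow> bool" where
  "residually_finite X f \<longleftrightarrow>
    (\<forall>x\<in>X. \<forall>y\<in>X. x \<noteq> y \<longrightarrow>
      (\<exists>(F :: nat set) g \<phi>. quandle F g \<and> finite F \<and>
        \<phi> \<in> quandle_hom X f F g \<and> \<phi> x \<noteq> \<phi> y))"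

text \<open>
  The universal property with respect to all quandles whose elements belong to the type
  \<open>'c\<close>. Homomorphisms are taken to be extensional, since only their values on the carrier matter.
\<close>

definition free_quandle_wrt ::
  "'c itself \<Rightarrow> 's set \<Rightarrow> 'q set \<Rightarrow> ('q \<Rightarrow> 'q \<Rightarrow> 'q) \<Rightarrow> ('s \<Rightarrow> 'q) \<Rightarrow> bool" where
  "free_quandle_wrt (_ :: 'c itself) S Q f \<phi> \<longleftrightarrow>
    quandle Q f \<and> \<phi> \<in> S \<rightarrow> Q \<and>
    (\<forall>(X :: 'c set) g \<rho>. quandle X g \<and> \<rho> \<in> S \<rightarrow> X \<longrightarrow>
      (\<exists>!\<psi>. \<psi> \<in> quandle_hom Q f X g \<and> \<psi> \<in> extensional Q \<and> (\<forall>s\<in>S. \<psi> (\<phi> s) = \<rho> s)))"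

text \<open>
  A formula of HOL cannot quantify over types, so the type of the test quandles has to be
  fixed. The type \<open>'q + 's + nat\<close> is large enough for this to be the
  unrestricted universal property; this is \<open>free_quandle_universal\<close> below.
\<close>

definition free_quandle ::
  "'s set \<Rightarrow> 'q set \<Rightarrow> ('q \<Rightarrow> 'q \<Rightarrow> 'q) \<Rightarrow> ('s \<Rightarrow> 'q) \<Rightarrow> bool" where
  "free_quandle S Q f \<phi> \<longleftrightarrow>
    free_quandle_wrt TYPE('q + 's + nat) S Q f \<phi>"

lemma quandle_transport:
  assumes "quandle X f" and inj: "inj_on h X"
  defines "g \<equiv> \<lambda>u v. h (f (inv_into X h u) (inv_into X h v))"
  shows "quandle (h ` X) g" "h \<in> quandle_hom X f (h ` X) g"
    "inv_into X h \<in> quandle_hom (h ` X) g X f"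
proof -
  interpret quandle X f by fact
  have g: "g (h x) (h y) = h (f x y)" if "x \<in> X" "y \<in> X" for x y
    using that inj by (simp add: g_def)
  have eq: "h x = h y \<longleftrightarrow> x = y" if "x \<in> X" "y \<in> X" for x y
    using that inj by (auto dest: inj_onD)
  show "quandle (h ` X) g"
  proof
    show "h ` X \<noteq> {}" using nonempty by simp
  next
    fix u v assume "u \<in> h ` X" "v \<in> h ` X"
    then show "g u v \<in> h ` X" by (auto simp: g closed)
  next
    fix u assume "u \<in> h ` X"
    then show "g u u = u" by (auto simp: g idem)
  next
    fix u v assume "u \<in> h ` X" "v \<in> h ` X"
    then obtain x y where xy: "x \<in> X" "y \<in> X" "u = h x" "v = h y" by auto
    from unique_div[OF xy(1,2)] obtain z where z: "z \<in> X" "x = f z y"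
      and uniq: "\<And>w. \<lbrakk>w \<in> X; x = f w y\<rbrakk> \<Longrightarrow> w = z" by auto
    show "\<exists>!w. w \<in> h ` X \<and> u = g w v"
    proof (rule ex1I[of _ "h z"])
      show "h z \<in> h ` X \<and> u = g (h z) v" using z xy by (simp add: g)
      show "w = h z" if "w \<in> h ` X \<and> u = g w v" for w
        using that xy uniq by (auto simp: g eq closed)
    qed
  next
    fix u v w assume "u \<in> h ` X" "v \<in> h ` X" "w \<in> h ` X"
    then obtain x y z where "x \<in> X" "y \<in> X" "z \<in> X" "u = h x" "v = h y" "w = h z" by auto
    then show "g (g u v) w = g (g u w) (g v w)"
      using self_distrib[of x y z] by (simp add: g closed)
  qed
  show "h \<in> quandle_hom X f (h ` X) g" by (auto simp: quandle_hom_def g)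
  show "inv_into X h \<in> quandle_hom (h ` X) g X f"
    using inj by (auto simp: quandle_hom_def g closed)
qed

lemma quandle_hom_comp:
  assumes "\<phi> \<in> quandle_hom X f Y g" "\<psi> \<in> quandle_hom Y g Z h"
  shows "(\<lambda>x. \<psi> (\<phi> x)) \<in> quandle_hom X f Z h"
  using assms by (auto simp: quandle_hom_def Pi_iff)

lemma residually_finiteI:
  assumes "\<And>x y. \<lbrakk>x \<in> X; y \<in> X; x \<noteq> y\<rbrakk> \<Longrightarrow>
    \<exists>(F :: 'b set) g \<phi>. quandle F g \<and> finite F \<and> \<phi> \<in> quandle_hom X f F g \<and> \<phi> x \<noteq> \<phi> y"
  shows "residually_finite X f"
  unfolding residually_finite_def
proof (intro ballI impI)
  fix x y assume xy: "x \<in> X" "y \<in> X" "x \<noteq> y"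
  from assms[OF this] obtain F :: "'b set" and g \<phi>
    where F: "quandle F g" "finite F" "\<phi> \<in> quandle_hom X f F g" "\<phi> x \<noteq> \<phi> y" by blast
  obtain h :: "'b \<Rightarrow> nat" where h: "inj_on h F"
    using finite_imp_inj_to_nat_seg[OF F(2)] by metis
  let ?g = "\<lambda>u v. h (g (inv_into F h u) (inv_into F h v))"
  note t = quandle_transport[OF F(1) h]
  have "\<phi> x \<in> F" "\<phi> y \<in> F" using F(3) xy by (auto simp: quandle_hom_def)
  then have "h (\<phi> x) \<noteq> h (\<phi> y)" using h F(4) by (auto dest: inj_onD)
  moreover have "finite (h ` F)" using F(2) by simp
  ultimately show "\<exists>(F :: nat set) g \<phi>. quandle F g \<and> finite F \<and>
      \<phi> \<in> quandle_hom X f F g \<and> \<phi> x \<noteq> \<phi> y"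
    using t(1) quandle_hom_comp[OF F(3) t(2)] by (intro exI conjI)
qed

lemma UN_lepoll_infinite:
  assumes "infinite U" "I \<lesssim> U" "\<And>i. i \<in> I \<Longrightarrow> A i \<lesssim> U"
  shows "(\<Union>i\<in>I. A i) \<lesssim> U"
  using card_of_UNION_ordLeq_infinite[of U I A] assms
  by (simp add: lepoll_def card_of_ordLeq)

lemma subquandle_bounded:
  fixes X :: "'c set" and U :: "'t set"
  assumes "quandle X f" and A: "A \<subseteq> X" "A \<noteq> {}" "A \<lesssim> U" and U: "infinite U"
  obtains Z where "A \<subseteq> Z" "Z \<subseteq> X" "Z \<lesssim> U" "quandle Z f"
proof -
  interpret quandle X f by fact
  define d where "d = (\<lambda>x y. THE z. z \<in> X \<and> x = f z y)"
  have d: "d x y \<in> X" "f (d x y) y = x" if "x \<in> X" "y \<in> X" for x y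
    using theI'[OF unique_div[OF that]] by (simp_all add: d_def)
  define step where "step = (\<lambda>Y. \<Union>x\<in>Y. \<Union>y\<in>Y. {x, f x y, d x y})"
  define Z where "Z = (\<Union>n. (step ^^ n) A)"
  have step_sub: "Y \<subseteq> X \<Longrightarrow> step Y \<subseteq> X" for Y
    by (auto simp: step_def subset_iff intro: closed d(1))
  have step_size: "step Y \<lesssim> U" if "Y \<lesssim> U" for Y
    unfolding step_def
    by (rule UN_lepoll_infinite[OF U that])+ (simp add: U finite_lepoll_infinite)
  have stage: "(step ^^ n) A \<subseteq> X" "(step ^^ n) A \<lesssim> U" for n
    by (induction n) (simp_all add: A step_sub step_size)
  have mono: "(step ^^ m) A \<subseteq> (step ^^ n) A" if "m \<le> n" for m n
    using that by (rule lift_Suc_mono_le[of "\<lambda>n. (step ^^ n) A", rotated]) (auto simp: step_def)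
  have Z_sub: "Z \<subseteq> X" using stage(1) by (auto simp: Z_def)
  have A_sub: "A \<subseteq> Z" unfolding Z_def by (rule order_trans[OF _ UN_upper[of 0]]) auto
  have Z_size: "Z \<lesssim> U"
    unfolding Z_def
  proof (rule UN_lepoll_infinite[OF U])
    show "(UNIV :: nat set) \<lesssim> U" using U by (simp add: infinite_le_lepoll)
  qed (rule stage(2))
  have Z_closed: "f x y \<in> Z \<and> d x y \<in> Z" if xy: "x \<in> Z" "y \<in> Z" for x y
  proof -
    obtain m n where "x \<in> (step ^^ m) A" "y \<in> (step ^^ n) A" using xy by (auto simp: Z_def)
    then have "x \<in> (step ^^ max m n) A" "y \<in> (step ^^ max m n) A"
      using mono[of m "max m n"] mono[of n "max m n"] by auto
    then have "f x y \<in> (step ^^ Suc (max m n)) A" "d x y \<in> (step ^^ Suc (max m n)) A"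
      by (auto simp: step_def)
    then show ?thesis unfolding Z_def by blast
  qed
  have "quandle Z f"
  proof
    show "Z \<noteq> {}" using A_sub A(2) by blast
  next
    fix x y assume xy: "x \<in> Z" "y \<in> Z"
    then show "f x y \<in> Z" using Z_closed by blast
    have "x \<in> X" "y \<in> X" using xy Z_sub by auto
    then show "\<exists>!z. z \<in> Z \<and> x = f z y"
      using unique_div[of x y] Z_closed[OF xy] d[of x y] Z_sub by (metis subsetD)
  next
    fix x assume "x \<in> Z"
    then show "f x x = x" using Z_sub idem by auto
  next
    fix x y z assume "x \<in> Z" "y \<in> Z" "z \<in> Z"
    then show "f (f x y) z = f (f x z) (f y z)" using Z_sub by (intro self_distrib) auto
  qed
  with A_sub Z_sub Z_size show ?thesis by (rule that)
qed

text \<open>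
  The proof uses that the values in an arbitrary quandle of \<open>\<rho>\<close>, or of
  two homomorphisms on \<open>Q\<close>, lie in a subquandle that embeds into \<open>'q + 's + nat\<close>.
\<close>

theorem free_quandle_universal:
  fixes S :: "'s set" and Q :: "'q set"
  assumes "S \<noteq> {}" and free: "free_quandle S Q f \<phi>"
  shows "free_quandle_wrt TYPE('c) S Q f \<phi>"
proof -
  let ?U = "UNIV :: ('q + 's + nat) set"
  have infU: "infinite ?U" by (simp add: finite_Plus_UNIV_iff)
  have sU: "S \<lesssim> ?U"
    unfolding lepoll_def by (rule exI[of _ "Inr \<circ> Inl"]) (auto simp: inj_on_def)
  have qU: "Q \<lesssim> ?U"
    unfolding lepoll_def by (rule exI[of _ Inl]) auto
  have Q: "quandle Q f" and \<phi>: "\<phi> \<in> S \<rightarrow> Q"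
    using free by (auto simp: free_quandle_def free_quandle_wrt_def)
  interpret quandle Q f by (rule Q)
  have univ: "\<exists>!\<psi>. \<psi> \<in> quandle_hom Q f X g \<and> \<psi> \<in> extensional Q \<and> (\<forall>s\<in>S. \<psi> (\<phi> s) = \<rho> s)"
    if "quandle X g" "\<rho> \<in> S \<rightarrow> X" for X :: "('q + 's + nat) set" and g \<rho>
    using free that by (auto simp: free_quandle_def free_quandle_wrt_def)
  have restr: "restrict \<psi> Q \<in> quandle_hom Q f X g" if "\<psi> \<in> quandle_hom Q f X g"
    for \<psi> and X :: "'x set" and g
    using that by (auto simp: quandle_hom_def closed)
  have "\<exists>!\<psi>. \<psi> \<in> quandle_hom Q f X g \<and> \<psi> \<in> extensional Q \<and> (\<forall>s\<in>S. \<psi> (\<phi> s) = \<rho> s)"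
    if X: "quandle X g" and \<rho>: "\<rho> \<in> S \<rightarrow> X" for X :: "'c set" and g \<rho>
  proof (rule ex_ex1I)
    have "\<rho> ` S \<lesssim> ?U" using image_lepoll sU by (rule lepoll_trans)
    then obtain Z where Z: "\<rho> ` S \<subseteq> Z" "Z \<subseteq> X" "Z \<lesssim> ?U" "quandle Z g"
      using subquandle_bounded[OF X, of "\<rho> ` S" ?U] \<rho> infU \<open>S \<noteq> {}\<close> by (metis Pi_iff image_subsetI image_is_empty)
    then obtain h :: "'c \<Rightarrow> 'q + 's + nat" where h: "inj_on h Z" by (auto simp: lepoll_def)
    note t = quandle_transport[OF Z(4) h]
    have "(\<lambda>s. h (\<rho> s)) \<in> S \<rightarrow> h ` Z" using Z(1) by auto
    from univ[OF t(1) this] obtain \<psi> where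
      \<psi>: "\<psi> \<in> quandle_hom Q f (h ` Z) (\<lambda>u v. h (g (inv_into Z h u) (inv_into Z h v)))"
        "\<forall>s\<in>S. \<psi> (\<phi> s) = h (\<rho> s)" by blast
    define \<chi> where "\<chi> = restrict (\<lambda>x. inv_into Z h (\<psi> x)) Q"
    have "\<chi> \<in> quandle_hom Q f Z g"
      unfolding \<chi>_def by (rule restr[OF quandle_hom_comp[OF \<psi>(1) t(3)]])
    then have "\<chi> \<in> quandle_hom Q f X g" using Z(2) by (auto simp: quandle_hom_def)
    moreover have "\<forall>s\<in>S. \<chi> (\<phi> s) = \<rho> s"
      using \<phi> \<psi>(2) h Z(1) by (auto simp: \<chi>_def Pi_iff image_subset_iff)
    ultimately show "\<exists>\<psi>. \<psi> \<in> quandle_hom Q f X g \<and> \<psi> \<in> extensional Q \<and> (\<forall>s\<in>S. \<psi> (\<phi> s) = \<rho> s)"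
      by (intro exI[of _ \<chi>]) (auto simp: \<chi>_def)
  next
    fix \<psi>1 \<psi>2
    assume 1: "\<psi>1 \<in> quandle_hom Q f X g \<and> \<psi>1 \<in> extensional Q \<and> (\<forall>s\<in>S. \<psi>1 (\<phi> s) = \<rho> s)"
      and 2: "\<psi>2 \<in> quandle_hom Q f X g \<and> \<psi>2 \<in> extensional Q \<and> (\<forall>s\<in>S. \<psi>2 (\<phi> s) = \<rho> s)"
    let ?A = "\<Union>x\<in>Q. {\<psi>1 x, \<psi>2 x}"
    have A: "?A \<subseteq> X" "?A \<noteq> {}"
      using 1 2 nonempty by (auto simp: quandle_hom_def)
    have "?A \<lesssim> ?U"
      by (rule UN_lepoll_infinite[OF infU qU]) (simp add: infU finite_lepoll_infinite)
    from subquandle_bounded[OF X A this infU]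
    obtain Z where Z: "?A \<subseteq> Z" "Z \<subseteq> X" "Z \<lesssim> ?U" "quandle Z g" by blast
    then obtain h :: "'c \<Rightarrow> 'q + 's + nat" where h: "inj_on h Z" by (auto simp: lepoll_def)
    note t = quandle_transport[OF Z(4) h]
    let ?g = "\<lambda>u v. h (g (inv_into Z h u) (inv_into Z h v))"
    have hom: "restrict (\<lambda>x. h (\<psi> x)) Q \<in> quandle_hom Q f (h ` Z) ?g"
      if "\<psi> = \<psi>1 \<or> \<psi> = \<psi>2" for \<psi>
    proof -
      have "\<psi> \<in> quandle_hom Q f Z g" using that 1 2 Z(1) by (auto simp: quandle_hom_def)
      then show ?thesis by (rule restr[OF quandle_hom_comp[OF _ t(2)]])
    qed
    have gen: "(\<lambda>s. h (\<rho> s)) \<in> S \<rightarrow> h ` Z"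
    proof
      fix s assume "s \<in> S"
      then have "\<phi> s \<in> Q" "\<psi>1 (\<phi> s) = \<rho> s" using \<phi> 1 by auto
      then show "h (\<rho> s) \<in> h ` Z" using Z(1) by force
    qed
    let ?P = "\<lambda>\<psi>. \<psi> \<in> quandle_hom Q f (h ` Z) ?g \<and> \<psi> \<in> extensional Q \<and>
      (\<forall>s\<in>S. \<psi> (\<phi> s) = h (\<rho> s))"
    have "?P (restrict (\<lambda>x. h (\<psi>1 x)) Q)" "?P (restrict (\<lambda>x. h (\<psi>2 x)) Q)"
      using hom 1 2 \<phi> by (auto simp: Pi_iff)
    then have eq: "restrict (\<lambda>x. h (\<psi>1 x)) Q = restrict (\<lambda>x. h (\<psi>2 x)) Q"
      using univ[OF t(1) gen] by blast
    show "\<psi>1 = \<psi>2"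
    proof (rule extensionalityI)
      show "\<psi>1 \<in> extensional Q" "\<psi>2 \<in> extensional Q" using 1 2 by auto
      fix x assume x: "x \<in> Q"
      then have "h (\<psi>1 x) = h (\<psi>2 x)" using fun_cong[OF eq, of x] by simp
      then show "\<psi>1 x = \<psi>2 x" using h x Z(1) by (auto dest: inj_onD)
    qed
  qed
  then show ?thesis using Q \<phi> by (simp add: free_quandle_wrt_def)
qed

end

theory Submission
  imports Defs "HOL-Combinatorics.Permutations"
begin

text \<open>
  By the universal property, \<open>FQ\<close> is generated by \<open>\<phi> ` S\<close>, so each of its elements arises from some
  \<open>\<phi> s\<close> by the right action of a word in the letters \<open>t\<close>, \<open>t\<^sup>-\<^sup>1\<close> for \<open>t \<in> S\<close>. To separate two
  elements, act on both by the inverse of the word of the second one; this leaves some \<open>\<phi> s \<cdot> w\<close> and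
  \<open>\<phi> t\<close>. If \<open>w\<close> has minimal length, then \<open>u = w\<^sup>-\<^sup>1 s w\<close> is a reduced word. A reduced word of length
  \<open>n\<close> labels a path \<open>0, \<dots>, n\<close> whose edges extend to permutations of \<open>{0..n}\<close>. In the conjugation
  quandle of these permutations \<open>\<phi> s \<cdot> w\<close> maps to the permutation given by \<open>u\<close>, and the path of \<open>u\<close> or \<open>t\<^sup>-\<^sup>1 u\<close> shows that this
  is not the permutation assigned to \<open>t\<close>.
\<close>

section \<open>Words\<close>

text \<open>The letter \<open>(a, True)\<close> stands for the generator \<open>a\<close>, and
  \<open>(a, False)\<close> for its inverse.\<close>

fun letter_inv :: "'s \<times> bool \<Rightarrow> 's \<times> bool" where
  "letter_inv (a, b) = (a, \<not> b)"

definition word_inv :: "('s \<times> bool) list \<Rightarrow> ('s \<times> bool) list" where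
  "word_inv w = rev (map letter_inv w)"

definition reduced :: "('s \<times> bool) list \<Rightarrow> bool" where
  "reduced w \<longleftrightarrow> successively (\<lambda>k l. l \<noteq> letter_inv k) w"

lemma letter_inv_letter_inv [simp]: "letter_inv (letter_inv l) = l"
  by (cases l) simp

lemma word_inv_simps [simp]:
  "word_inv [] = []"
  "word_inv (l # w) = word_inv w @ [letter_inv l]"
  "length (word_inv w) = length w"
  by (simp_all add: word_inv_def)

lemma word_inv_in_lists:
  assumes "w \<in> lists (S \<times> UNIV)"
  shows "word_inv w \<in> lists (S \<times> UNIV)"
  using assms by (induction w) auto

lemma reduced_word_inv:
  assumes "reduced w"
  shows "reduced (word_inv w)"
  using assms unfolding reduced_def word_inv_def successively_rev successively_map
  by (rule successively_mono) (metis letter_inv_letter_inv)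

lemma not_reducedE:
  assumes "\<not> reduced w"
  obtains v l v' where "w = v @ l # letter_inv l # v'"
proof -
  have "\<exists>v l v'. w = v @ l # letter_inv l # v'"
    using assms
  proof (induction w rule: induct_list012)
    case (3 k l w)
    show ?case
    proof (cases "l = letter_inv k")
      case True
      then show ?thesis by (metis append_Nil)
    next
      case False
      then have "\<not> reduced (l # w)"
        using 3 by (simp add: reduced_def)
      then show ?thesis
        using 3 by (metis append_Cons)
    qed
  qed (simp_all add: reduced_def)
  then show ?thesis using that by blast
qed

text \<open>Both outer factors are reduced, so a cancellation could only involve the middle letter.
  Its neighbours, if any, are the first letter of \<open>w\<close> and its inverse, whose generator
  is not \<open>s\<close>.\<close>

lemma reduced_conjugate:
  assumes "reduced w" and "w = [] \<or> fst (hd w) \<noteq> s"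
  shows "reduced (word_inv w @ (s, True) # w)"
proof (cases w)
  case Nil
  then show ?thesis by (simp add: reduced_def)
next
  case (Cons k v)
  have "reduced (word_inv w)" using assms(1) by (rule reduced_word_inv)
  then show ?thesis
    using assms Cons by (cases k) (auto simp: reduced_def successively_append_iff successively_Cons)
qed

section \<open>The action of words on a quandle\<close>

definition quandle_div :: "'a set \<Rightarrow> ('a \<Rightarrow> 'a \<Rightarrow> 'a) \<Rightarrow> 'a \<Rightarrow> 'a \<Rightarrow> 'a" where
  "quandle_div X f x y = (THE z. z \<in> X \<and> x = f z y)"

definition letter_act ::
  "'a set \<Rightarrow> ('a \<Rightarrow> 'a \<Rightarrow> 'a) \<Rightarrow> ('s \<Rightarrow> 'a) \<Rightarrow> 'a \<Rightarrow> 's \<times> bool \<Rightarrow> 'a" where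
  "letter_act X f \<phi> x l = (if snd l then f x (\<phi> (fst l)) else quandle_div X f x (\<phi> (fst l)))"

abbreviation word_act ::
  "'a set \<Rightarrow> ('a \<Rightarrow> 'a \<Rightarrow> 'a) \<Rightarrow> ('s \<Rightarrow> 'a) \<Rightarrow> 'a \<Rightarrow> ('s \<times> bool) list \<Rightarrow> 'a" where
  "word_act X f \<phi> \<equiv> foldl (letter_act X f \<phi>)"

context quandle
begin

lemma div_closed: "\<lbrakk>x \<in> X; y \<in> X\<rbrakk> \<Longrightarrow> quandle_div X star x y \<in> X"
  and star_div: "\<lbrakk>x \<in> X; y \<in> X\<rbrakk> \<Longrightarrow> star (quandle_div X star x y) y = x"
  using theI'[OF unique_div] by (auto simp: quandle_div_def)

lemma div_eqI: "\<lbrakk>z \<in> X; y \<in> X; star z y = x\<rbrakk> \<Longrightarrow> quandle_div X star x y = z"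
  unfolding quandle_div_def by (rule the1_equality[OF unique_div]) (auto intro: closed)

lemma div_star: "\<lbrakk>x \<in> X; y \<in> X\<rbrakk> \<Longrightarrow> quandle_div X star (star x y) y = x"
  by (simp add: div_eqI)

lemma div_idem: "x \<in> X \<Longrightarrow> quandle_div X star x x = x"
  by (simp add: div_eqI idem)

text \<open>Here and in the next three lemmas, self-distributivity makes translation by a product or
  quotient of \<open>y\<close> and \<open>z\<close> a conjugate of translation by \<open>y\<close>.
  Hence translating by an element of the orbit of a generator amounts to a chain of translations by
  generators and their inverses.\<close>

lemma star_star:
  assumes "x \<in> X" "y \<in> X" "z \<in> X"
  shows "star x (star y z) = star (star (quandle_div X star x z) y) z"
  using self_distrib[of "quandle_div X star x z" y z] assms by (simp add: div_closed star_div)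

lemma star_div_right:
  assumes "x \<in> X" "y \<in> X" "z \<in> X"
  shows "star x (quandle_div X star y z) = quandle_div X star (star (star x z) y) z"
  using self_distrib[of x "quandle_div X star y z" z] assms
  by (intro div_eqI[symmetric]) (simp_all add: div_closed star_div closed)

lemma div_star_right:
  assumes "x \<in> X" "y \<in> X" "z \<in> X"
  shows "quandle_div X star x (star y z) =
    star (quandle_div X star (quandle_div X star x z) y) z"
  using assms by (intro div_eqI) (simp_all add: closed div_closed star_star div_star star_div)

lemma div_div_right:
  assumes "x \<in> X" "y \<in> X" "z \<in> X"
  shows "quandle_div X star x (quandle_div X star y z) =
    quandle_div X star (quandle_div X star (star x z) y) z"
  using assms by (intro div_eqI) (simp_all add: closed div_closed star_div_right div_star star_div)

context
  fixes S :: "'s set" and \<phi> :: "'s \<Rightarrow> 'a"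
  assumes \<phi>: "\<phi> \<in> S \<rightarrow> X"
begin

lemma letter_act_closed: "\<lbrakk>x \<in> X; l \<in> S \<times> UNIV\<rbrakk> \<Longrightarrow> letter_act X star \<phi> x l \<in> X"
  using \<phi> by (auto simp: letter_act_def intro!: closed div_closed)

lemma word_act_closed: "\<lbrakk>x \<in> X; w \<in> lists (S \<times> UNIV)\<rbrakk> \<Longrightarrow> word_act X star \<phi> x w \<in> X"
  by (induction w arbitrary: x) (auto simp: letter_act_closed)

lemma letter_act_inv:
  "\<lbrakk>x \<in> X; l \<in> S \<times> UNIV\<rbrakk> \<Longrightarrow> letter_act X star \<phi> (letter_act X star \<phi> x l) (letter_inv l) = x"
  using \<phi> by (cases l) (auto simp: letter_act_def Pi_iff div_star star_div)

lemma word_act_inv: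
  "\<lbrakk>x \<in> X; w \<in> lists (S \<times> UNIV)\<rbrakk> \<Longrightarrow>
    word_act X star \<phi> (word_act X star \<phi> x w) (word_inv w) = x"
  by (induction w arbitrary: x) (auto simp: letter_act_closed letter_act_inv)

lemma word_act_inj:
  assumes "x \<in> X" "y \<in> X" "w \<in> lists (S \<times> UNIV)"
    and "word_act X star \<phi> x w = word_act X star \<phi> y w"
  shows "x = y"
  using word_act_inv[of x w] word_act_inv[of y w] assms by metis

text \<open>Adjacent inverse letters could be dropped without changing the element reached. So could
  a first letter \<open>s\<close> or its inverse, since by idempotence both fix
  \<open>\<phi> s\<close>.\<close>

lemma shortest_word_reduced:
  assumes s: "s \<in> S" and w: "w \<in> lists (S \<times> UNIV)"
    and shortest: "\<And>v. \<lbrakk>v \<in> lists (S \<times> UNIV); word_act X star \<phi> (\<phi> s) v = word_act X star \<phi> (\<phi> s) w\<rbrakk>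
      \<Longrightarrow> length w \<le> length v"
  shows "reduced (word_inv w @ (s, True) # w)"
proof (rule reduced_conjugate)
  have \<phi>s: "\<phi> s \<in> X" using \<phi> s by auto
  show "reduced w"
  proof (rule ccontr)
    assume "\<not> reduced w"
    then obtain v l v' where eq: "w = v @ l # letter_inv l # v'" by (rule not_reducedE)
    then have "word_act X star \<phi> (\<phi> s) (v @ v') = word_act X star \<phi> (\<phi> s) w"
      using w \<phi>s by (simp add: letter_act_inv word_act_closed)
    then show False using shortest[of "v @ v'"] w eq by simp
  qed
  show "w = [] \<or> fst (hd w) \<noteq> s"
  proof (rule ccontr)
    assume "\<not> (w = [] \<or> fst (hd w) \<noteq> s)"
    then obtain b v where eq: "w = (s, b) # v" by (cases w) auto
    then have "word_act X star \<phi> (\<phi> s) v = word_act X star \<phi> (\<phi> s) w"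
      using \<phi>s by (simp add: letter_act_def idem div_idem)
    then show False using shortest[of v] w eq by simp
  qed
qed

text \<open>This is the subquandle generated by the values of \<open>\<phi>\<close>. It is closed
  because translating by one of its elements is a chain of translations by generators, each of which
  appends a letter.\<close>

lemma quandle_orbits:
  assumes "S \<noteq> {}"
  shows "quandle {word_act X star \<phi> (\<phi> s) w | s w. s \<in> S \<and> w \<in> lists (S \<times> UNIV)} star"
    (is "quandle ?G star")
proof -
  have sub: "?G \<subseteq> X" using \<phi> by (auto intro!: word_act_closed)
  have letter: "letter_act X star \<phi> x l \<in> ?G" if x: "x \<in> ?G" and l: "l \<in> S \<times> UNIV" for x l
  proof -
    obtain s w where sw: "x = word_act X star \<phi> (\<phi> s) w" "s \<in> S" "w \<in> lists (S \<times> UNIV)"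
      using x by blast
    then have "letter_act X star \<phi> x l = word_act X star \<phi> (\<phi> s) (w @ [l])" by simp
    then show ?thesis using sw l by fastforce
  qed
  have gen: "star x (\<phi> s) \<in> ?G" "quandle_div X star x (\<phi> s) \<in> ?G" if "x \<in> ?G" "s \<in> S" for x s
    using letter[OF that(1), of "(s, True)"] letter[OF that(1), of "(s, False)"] that(2)
    by (simp_all add: letter_act_def)
  \<comment> \<open>The quantifier over \<open>x\<close> stays inside the induction because the
    conjugation formulas need the hypothesis at a translate of \<open>x\<close>.\<close>
  have word: "\<forall>x\<in>?G. star x (word_act X star \<phi> (\<phi> s) w) \<in> ?G \<and>
      quandle_div X star x (word_act X star \<phi> (\<phi> s) w) \<in> ?G"
    if s: "s \<in> S" and w: "w \<in> lists (S \<times> UNIV)" for s w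
    using w
  proof (induction w rule: rev_induct)
    case Nil
    show ?case using gen[OF _ s] by simp
  next
    case (snoc l w)
    obtain t b where l: "l = (t, b)" "t \<in> S" using snoc.prems by (cases l) auto
    let ?y = "word_act X star \<phi> (\<phi> s) w"
    have in_X: "?y \<in> X" "\<phi> t \<in> X" using snoc.prems s l \<phi> by (auto intro!: word_act_closed)
    have IH: "star x ?y \<in> ?G" "quandle_div X star x ?y \<in> ?G" if "x \<in> ?G" for x
      using snoc that by auto
    show ?case
    proof
      fix x assume x: "x \<in> ?G"
      then have "x \<in> X" using sub by blast
      then show "star x (word_act X star \<phi> (\<phi> s) (w @ [l])) \<in> ?G \<and>
          quandle_div X star x (word_act X star \<phi> (\<phi> s) (w @ [l])) \<in> ?G"
        using gen[OF _ l(2)] IH x in_X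
        by (cases b) (simp_all only: foldl_append foldl.simps l(1) letter_act_def fst_conv snd_conv
            if_True if_False star_star star_div_right div_star_right div_div_right)
    qed
  qed
  have G_closed: "star x y \<in> ?G" "quandle_div X star x y \<in> ?G" if "x \<in> ?G" "y \<in> ?G" for x y
    using word that by blast+
  show ?thesis
  proof
    obtain s where "s \<in> S" using assms by blast
    then show "?G \<noteq> {}" by blast
  next
    fix x y assume xy: "x \<in> ?G" "y \<in> ?G"
    then have "x \<in> X" "y \<in> X" using sub by auto
    then show "\<exists>!z. z \<in> ?G \<and> x = star z y"
    proof (intro ex1I conjI)
      show "quandle_div X star x y \<in> ?G" using xy by (rule G_closed)
      show "x = star (quandle_div X star x y) y" using \<open>x \<in> X\<close> \<open>y \<in> X\<close> by (rule star_div[symmetric])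
      show "z = quandle_div X star x y" if z: "z \<in> ?G \<and> x = star z y" for z
      proof -
        have "z \<in> X" using z sub by blast
        then show ?thesis using z \<open>y \<in> X\<close> by (intro div_eqI[symmetric]) simp_all
      qed
    qed
  next
    fix x y assume xy: "x \<in> ?G" "y \<in> ?G"
    then show "star x y \<in> ?G" by (rule G_closed)
  next
    fix x assume "x \<in> ?G"
    then show "star x x = x" using sub idem by blast
  next
    fix x y z assume "x \<in> ?G" "y \<in> ?G" "z \<in> ?G"
    then show "star (star x y) z = star (star x z) (star y z)"
      using sub by (intro self_distrib) auto
  qed
qed

end

end

section \<open>Homomorphisms and generation of the free quandle\<close>

lemma hom_letter_act:
  assumes X: "quandle X f" and Y: "quandle Y g" and \<psi>: "\<psi> \<in> quandle_hom X f Y g"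
    and \<phi>: "\<phi> \<in> S \<rightarrow> X" and \<rho>: "\<forall>s\<in>S. \<psi> (\<phi> s) = \<rho> s"
    and x: "x \<in> X" and l: "l \<in> S \<times> UNIV"
  shows "\<psi> (letter_act X f \<phi> x l) = letter_act Y g \<rho> (\<psi> x) l"
proof -
  interpret X: quandle X f by fact
  interpret Y: quandle Y g by fact
  obtain s b where sb: "l = (s, b)" "s \<in> S" using l by auto
  then have \<phi>s: "\<phi> s \<in> X" using \<phi> by auto
  have hom: "\<psi> y \<in> Y" "\<psi> (f y z) = g (\<psi> y) (\<psi> z)" if "y \<in> X" "z \<in> X" for y z
    using \<psi> that by (auto simp: quandle_hom_def)
  let ?z = "quandle_div X f x (\<phi> s)"
  have z: "?z \<in> X" using x \<phi>s by (rule X.div_closed)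
  \<comment> \<open>Since \<open>\<psi>\<close> preserves the operation, \<open>\<psi> ?z\<close>
    solves the division equation in \<open>Y\<close>, whose solution is unique.\<close>
  have "quandle_div Y g (\<psi> x) (\<psi> (\<phi> s)) = \<psi> ?z"
    using hom(1)[OF z z] hom(1)[OF \<phi>s \<phi>s] hom(2)[OF z \<phi>s] X.star_div[OF x \<phi>s]
    by (intro Y.div_eqI) simp_all
  then show ?thesis using sb \<rho> hom x \<phi>s by (simp add: letter_act_def)
qed

lemma hom_word_act:
  assumes "quandle X f" "quandle Y g" "\<psi> \<in> quandle_hom X f Y g"
    and "\<phi> \<in> S \<rightarrow> X" "\<forall>s\<in>S. \<psi> (\<phi> s) = \<rho> s"
    and "x \<in> X" "w \<in> lists (S \<times> UNIV)"
  shows "\<psi> (word_act X f \<phi> x w) = word_act Y g \<rho> (\<psi> x) w"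
  using assms(6,7)
  by (induction w arbitrary: x)
    (simp_all add: hom_letter_act[OF assms(1-5)] quandle.letter_act_closed[OF assms(1,4)])

text \<open>The universal property maps \<open>Q\<close> into the subquandle \<open>?G\<close> of
  orbits. Followed by the inclusion this is an endomorphism of \<open>Q\<close> fixing every
  \<open>\<phi> s\<close>, so by uniqueness the identity; hence \<open>?G\<close> is all of
  \<open>Q\<close>.\<close>

lemma free_quandle_generated:
  fixes Q :: "'q set"
  assumes S: "S \<noteq> {}" and free: "free_quandle S Q f \<phi>" and x: "x \<in> Q"
  obtains s w where "s \<in> S" "w \<in> lists (S \<times> UNIV)" "x = word_act Q f \<phi> (\<phi> s) w"
proof -
  have Q: "quandle Q f" and \<phi>: "\<phi> \<in> S \<rightarrow> Q"
    using free by (auto simp: free_quandle_def free_quandle_wrt_def)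
  interpret quandle Q f by (rule Q)
  have univ: "\<exists>!\<psi>. \<psi> \<in> quandle_hom Q f X g \<and> \<psi> \<in> extensional Q \<and> (\<forall>s\<in>S. \<psi> (\<phi> s) = \<rho> s)"
    if "quandle X g" "\<rho> \<in> S \<rightarrow> X" for X :: "'q set" and g \<rho>
    using free_quandle_universal[OF S free, where ?'c = 'q] that by (simp add: free_quandle_wrt_def)
  let ?G = "{word_act Q f \<phi> (\<phi> s) w | s w. s \<in> S \<and> w \<in> lists (S \<times> UNIV)}"
  have G: "quandle ?G f" using \<phi> S by (rule quandle_orbits)
  have sub: "?G \<subseteq> Q" using \<phi> by (auto intro!: word_act_closed[OF \<phi>])
  have "\<phi> \<in> S \<rightarrow> ?G"
  proof
    fix s assume "s \<in> S"
    moreover have "\<phi> s = word_act Q f \<phi> (\<phi> s) []" by simp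
    ultimately show "\<phi> s \<in> ?G" by blast
  qed
  from univ[OF G this] obtain \<psi> where \<psi>: "\<psi> \<in> quandle_hom Q f ?G f" "\<psi> \<in> extensional Q"
    "\<forall>s\<in>S. \<psi> (\<phi> s) = \<phi> s" by blast
  have "\<psi> \<in> quandle_hom Q f Q f" using \<psi>(1) sub unfolding quandle_hom_def by blast
  moreover have "restrict id Q \<in> quandle_hom Q f Q f" by (auto simp: quandle_hom_def closed)
  moreover have "\<forall>s\<in>S. restrict id Q (\<phi> s) = \<phi> s" using \<phi> by auto
  ultimately have "\<psi> = restrict id Q"
    using univ[OF Q \<phi>] \<psi>(2,3) by (metis restrict_extensional)
  then have "x = \<psi> x" using x by simp
  also have "\<dots> \<in> ?G" using \<psi>(1) x by (auto simp only: quandle_hom_def Pi_iff mem_Collect_eq)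
  finally show ?thesis using that by blast
qed

section \<open>Conjugation quandles of permutations\<close>

definition perm_conj :: "('a \<Rightarrow> 'a) \<Rightarrow> ('a \<Rightarrow> 'a) \<Rightarrow> 'a \<Rightarrow> 'a" where
  "perm_conj p q = q \<circ> p \<circ> inv q"

text \<open>Letters act on points, so folding along a word from left to right walks along a
  path.\<close>

definition letter_perm :: "('s \<Rightarrow> 'a \<Rightarrow> 'a) \<Rightarrow> 'a \<Rightarrow> 's \<times> bool \<Rightarrow> 'a" where
  "letter_perm P i l = (if snd l then P (fst l) i else inv (P (fst l)) i)"

lemma perm_conj_eq_iff:
  assumes "q permutes A"
  shows "x = perm_conj z q \<longleftrightarrow> z = inv q \<circ> x \<circ> q"
  using permutes_inv_o[OF assms] unfolding perm_conj_def
  by (metis comp_assoc comp_id id_comp)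

lemma quandle_perm_conj: "quandle {p. p permutes A} perm_conj"
proof
  show "{p. p permutes A} \<noteq> {}" using permutes_id by blast
next
  fix x y assume "x \<in> {p. p permutes A}" "y \<in> {p. p permutes A}"
  then have xy: "x permutes A" "y permutes A" by auto
  then show "perm_conj x y \<in> {p. p permutes A}"
    by (simp add: perm_conj_def permutes_compose permutes_inv)
  have "inv y \<circ> x \<circ> y permutes A" using xy by (simp add: permutes_compose permutes_inv)
  then show "\<exists>!z. z \<in> {p. p permutes A} \<and> x = perm_conj z y"
    using perm_conj_eq_iff[OF xy(2)] by auto
next
  fix x assume "x \<in> {p. p permutes A}"
  then have "x permutes A" by simp
  from permutes_inv_o(1)[OF this] show "perm_conj x x = x"
    by (simp add: perm_conj_def comp_assoc)
next
  fix x y z assume "x \<in> {p. p permutes A}" "y \<in> {p. p permutes A}" "z \<in> {p. p permutes A}"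
  then have "bij y" "bij z" by (auto intro: permutes_bij)
  then show "perm_conj (perm_conj x y) z = perm_conj (perm_conj x z) (perm_conj y z)"
    by (simp add: perm_conj_def fun_eq_iff o_inv_distrib bij_comp bij_imp_bij_inv inv_inv_eq
        bij_is_inj)
qed

context
  fixes P :: "'s \<Rightarrow> 'a \<Rightarrow> 'a" and A :: "'a set"
  assumes P: "\<And>a. P a permutes A"
begin

lemma letter_perm_inv: "letter_perm P (letter_perm P i l) (letter_inv l) = i"
  by (cases l) (auto simp: letter_perm_def permutes_inverses[OF P])

lemma word_perm_inv: "foldl (letter_perm P) (foldl (letter_perm P) i (word_inv w)) w = i"
proof (induction w arbitrary: i)
  case (Cons l w)
  show ?case using letter_perm_inv[of _ "letter_inv l"] Cons by simp
qed simp

text \<open>Acting by a letter conjugates \<open>p\<close>, which relabels the points. Evaluating at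
  a relabelled point lets the rule iterate along a word.\<close>

lemma letter_act_perm:
  assumes "p permutes A"
  shows "letter_act {p. p permutes A} perm_conj P p l permutes A"
    and "letter_act {p. p permutes A} perm_conj P p l (letter_perm P i l) = letter_perm P (p i) l"
proof -
  interpret quandle "{p. p permutes A}" perm_conj by (rule quandle_perm_conj)
  show "letter_act {p. p permutes A} perm_conj P p l permutes A"
    using letter_act_closed[of P UNIV p l] P assms by (cases l) auto
  have "inv (P a) \<circ> p \<circ> P a permutes A" for a
    using P assms by (simp add: permutes_compose permutes_inv)
  then have "quandle_div {p. p permutes A} perm_conj p (P a) = inv (P a) \<circ> p \<circ> P a" for a
    using perm_conj_eq_iff[OF P] P by (intro div_eqI) (simp_all, metis)
  then show "letter_act {p. p permutes A} perm_conj P p l (letter_perm P i l) = letter_perm P (p i) l"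
    by (auto simp: letter_act_def letter_perm_def perm_conj_def permutes_inverses[OF P])
qed

lemma word_act_perm:
  assumes "p permutes A"
  shows "word_act {p. p permutes A} perm_conj P p w (foldl (letter_perm P) i w) =
    foldl (letter_perm P) (p i) w"
  using assms by (induction w arbitrary: p i) (simp_all add: letter_act_perm)

text \<open>The point \<open>i\<close> is the end of a walk along \<open>w\<close> that starts where
  \<open>word_inv w\<close> leads from \<open>i\<close>. The relabelling rule applies at that
  start.\<close>

lemma word_act_perm_conj:
  "word_act {p. p permutes A} perm_conj P (P s) w i =
    foldl (letter_perm P) i (word_inv w @ (s, True) # w)"
  using word_act_perm[OF P[of s], of w "foldl (letter_perm P) i (word_inv w)"]
  by (simp add: word_perm_inv letter_perm_def)

end

section \<open>Permutations from paths of reduced words\<close>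

lemma inj_on_extends_to_permutation:
  assumes "finite A" "D \<subseteq> A" "inj_on f D" "f ` D \<subseteq> A"
  obtains p where "p permutes A" "\<And>x. x \<in> D \<Longrightarrow> p x = f x"
proof -
  \<comment> \<open>Equal size of the two complements provides a bijection that completes
    \<open>f\<close>.\<close>
  have "card (A - D) = card (A - f ` D)"
    using assms by (simp add: card_Diff_subset finite_subset card_image)
  then obtain g where g: "bij_betw g (A - D) (A - f ` D)"
    using assms(1) finite_same_card_bij by blast
  let ?h = "\<lambda>x. if x \<in> D then f x else g x"
  have "bij_betw ?h D (f ` D)" using assms(3) by (auto simp: bij_betw_def inj_on_def)
  moreover have "bij_betw ?h (A - D) (A - f ` D)" using g by (auto intro: bij_betw_cong[THEN iffD1, rotated])
  ultimately have "bij_betw ?h (D \<union> (A - D)) (f ` D \<union> (A - f ` D))"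
    by (rule bij_betw_combine) auto
  then have bij: "bij_betw ?h A A" using assms by (simp add: Un_absorb1)
  let ?p = "\<lambda>x. if x \<in> A then ?h x else x"
  have "bij_betw ?p A A" using bij by (simp cong: bij_betw_cong)
  then have "?p permutes A" by (rule bij_imp_permutes) simp
  moreover have "?p x = f x" if "x \<in> D" for x using that assms(2) by auto
  ultimately show ?thesis by (rule that)
qed

text \<open>Edge \<open>i\<close> joins \<open>i\<close> to \<open>Suc i\<close>. The edges labelled
  by \<open>a\<close> or its inverse prescribe a partial map for \<open>a\<close>, and a conflict
  could only arise between two consecutive edges with inverse labels.\<close>

lemma reduced_path_permutations:
  assumes "reduced u"
  obtains P where "\<And>a. P a permutes {..length u}"
    and "\<And>i. i < length u \<Longrightarrow> letter_perm P i (u ! i) = Suc i"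
proof -
  have red: "u ! Suc i \<noteq> letter_inv (u ! i)" if "Suc i < length u" for i
    using assms that by (auto simp: reduced_def successively_conv_nth)
  have "\<exists>p. p permutes {..length u} \<and>
      (\<forall>i<length u. (u ! i = (a, True) \<longrightarrow> p i = Suc i) \<and> (u ! i = (a, False) \<longrightarrow> p (Suc i) = i))"
    for a
  proof -
    let ?up = "{i. i < length u \<and> u ! i = (a, True)}"
    let ?down = "{i. i < length u \<and> u ! i = (a, False)}"
    let ?f = "\<lambda>i. if i \<in> ?up then Suc i else i - 1"
    \<comment> \<open>\<open>disj\<close> makes the partial map single-valued: \<open>Suc i\<close>
      is not sent both back and forward. \<open>ne\<close> makes it injective: \<open>Suc i\<close>
      is not reached from both sides.\<close>
    have disj: "Suc i \<notin> ?up" if "i \<in> ?down" for i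
      using that red[of i] by auto
    have ne: "Suc i \<notin> ?down" if "i \<in> ?up" for i
      using that red[of i] by auto
    have f_up: "?f i = Suc i" if "i \<in> ?up" for i using that by simp
    have f_down: "?f (Suc i) = i" if "i \<in> ?down" for i using disj[OF that] by auto
    have "inj_on ?f (?up \<union> Suc ` ?down)"
    proof (rule inj_onI)
      fix x y assume x: "x \<in> ?up \<union> Suc ` ?down" and y: "y \<in> ?up \<union> Suc ` ?down"
        and eq: "?f x = ?f y"
      consider "x \<in> ?up" "y \<in> ?up" | i where "x \<in> ?up" "y = Suc i" "i \<in> ?down"
        | i where "y \<in> ?up" "x = Suc i" "i \<in> ?down"
        | i j where "x = Suc i" "i \<in> ?down" "y = Suc j" "j \<in> ?down"
        using x y by blast
      then show "x = y"
      proof cases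
        case 1
        then show ?thesis using eq f_up[of x] f_up[of y] by simp
      next
        case (2 i)
        then have "i = Suc x" using eq f_up[of x] f_down[of i] by metis
        then show ?thesis using ne[OF 2(1)] 2(3) by simp
      next
        case (3 i)
        then have "i = Suc y" using eq f_up[of y] f_down[of i] by metis
        then show ?thesis using ne[OF 3(1)] 3(3) by simp
      next
        case (4 i j)
        then show ?thesis using eq f_down[OF 4(2)] f_down[OF 4(4)] by (simp only:)
      qed
    qed
    moreover have "?up \<union> Suc ` ?down \<subseteq> {..length u}" by auto
    moreover have "?f ` (?up \<union> Suc ` ?down) \<subseteq> {..length u}" by auto
    ultimately obtain p where p: "p permutes {..length u}"
      "\<And>x. x \<in> ?up \<union> Suc ` ?down \<Longrightarrow> p x = ?f x"
      using inj_on_extends_to_permutation[of "{..length u}" _ ?f] finite_atMost by blast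
    have "p i = Suc i" if "i \<in> ?up" for i using p(2)[of i] f_up[OF that] that by simp
    moreover have "p (Suc i) = i" if "i \<in> ?down" for i
      using p(2)[of "Suc i"] f_down[OF that] that by simp
    ultimately show ?thesis using p(1) by blast
  qed
  then obtain P where P: "\<And>a. P a permutes {..length u}"
    "\<And>a i. i < length u \<Longrightarrow> u ! i = (a, True) \<Longrightarrow> P a i = Suc i"
    "\<And>a i. i < length u \<Longrightarrow> u ! i = (a, False) \<Longrightarrow> P a (Suc i) = i"
    by metis
  have "letter_perm P i (u ! i) = Suc i" if "i < length u" for i
    using P(2,3)[OF that] permutes_inv_eq[OF P(1)]
    by (cases "u ! i") (auto simp: letter_perm_def)
  with P(1) show ?thesis by (rule that)
qed

lemma foldl_path:
  assumes "\<And>i. i < length u \<Longrightarrow> F i (u ! i) = Suc i"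
  shows "foldl F 0 u = length u"
proof -
  have "foldl F 0 (take k u) = k" if "k \<le> length u" for k
    using that by (induction k) (simp_all add: take_Suc_conv_app_nth assms)
  from this[of "length u"] show ?thesis by simp
qed

text \<open>For \<open>w = []\<close> and \<open>s = t\<close> both permutations would be
  \<open>P t\<close>; \<open>ne\<close> excludes this. Otherwise their values at one point of a path
  differ.\<close>

lemma separating_permutations:
  assumes red: "reduced (word_inv w @ (s, True) # w)" and ne: "w = [] \<Longrightarrow> s \<noteq> t"
  obtains n P where "\<forall>a. P a permutes {..n::nat}"
    and "word_act {p. p permutes {..n}} perm_conj P (P s) w \<noteq> P t"
proof -
  define u where "u = word_inv w @ (s, True) # w"
  have red_u: "reduced u" using red by (simp add: u_def)
  show ?thesis
  proof (cases "hd u = (t, True)")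
    \<comment> \<open>On the path of \<open>u\<close>, the first edge shows that \<open>P t\<close>
      sends 0 to 1, while all of \<open>u\<close> leads from 0 to \<open>length u\<close>, which is
      not 1 because \<open>w\<close> is non-empty.\<close>
    case True
    obtain P where P: "\<And>a. P a permutes {..length u}"
      "\<And>i. i < length u \<Longrightarrow> letter_perm P i (u ! i) = Suc i"
      using reduced_path_permutations[OF red_u] by blast
    have "u \<noteq> []" by (simp add: u_def)
    then have "P t 0 = 1"
      using P(2)[of 0] True by (simp add: letter_perm_def hd_conv_nth)
    moreover have "word_act {p. p permutes {..length u}} perm_conj P (P s) w 0 = length u"
      unfolding word_act_perm_conj[where P = P, OF P(1)] u_def[symmetric] by (rule foldl_path) (rule P(2))
    moreover have "w \<noteq> []" using True ne by (auto simp: u_def)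
    then have "length u \<noteq> 1" by (simp add: u_def)
    ultimately have "word_act {p. p permutes {..length u}} perm_conj P (P s) w 0 \<noteq> P t 0" by simp
    then show ?thesis using P(1) by (intro that[where P = P]) auto
  next
    \<comment> \<open>Prefixing the inverse of \<open>t\<close> keeps the word reduced and adds an
      edge from 0 to 1. So \<open>P t\<close> sends 1 to 0, while \<open>u\<close> leads from 1 to
      the far end.\<close>
    case False
    let ?u = "(t, False) # u"
    have "reduced ?u" using red_u False by (auto simp: reduced_def successively_Cons)
    then obtain P where P: "\<And>a. P a permutes {..length ?u}"
      "\<And>i. i < length ?u \<Longrightarrow> letter_perm P i (?u ! i) = Suc i"
      using reduced_path_permutations[of ?u] by blast
    have first: "inv (P t) 0 = 1" using P(2)[of 0] by (simp add: letter_perm_def)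
    then have "P t 1 = 0" by (metis P(1) permutes_inverses(1))
    moreover have "word_act {p. p permutes {..length ?u}} perm_conj P (P s) w 1 = length ?u"
      unfolding word_act_perm_conj[where P = P, OF P(1)] u_def[symmetric]
      using foldl_path[of ?u "letter_perm P"] P(2) first by (simp add: letter_perm_def)
    ultimately have "word_act {p. p permutes {..length ?u}} perm_conj P (P s) w 1 \<noteq> P t 1" by simp
    then show ?thesis using P(1) by (intro that[where P = P]) auto
  qed
qed

section \<open>Residual finiteness\<close>

theorem theorem5p3:
  fixes S :: "'s set" and FQ :: "'q set" and star :: "'q \<Rightarrow> 'q \<Rightarrow> 'q" and \<phi> :: "'s \<Rightarrow> 'q"
  assumes "S \<noteq> {}" and "free_quandle S FQ star \<phi>"
  shows "residually_finite FQ star"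
proof (rule residually_finiteI)
  have Q: "quandle FQ star" and \<phi>: "\<phi> \<in> S \<rightarrow> FQ"
    using assms(2) by (auto simp: free_quandle_def free_quandle_wrt_def)
  interpret quandle FQ star by (rule Q)
  fix x y assume xy: "x \<in> FQ" "y \<in> FQ" "x \<noteq> y"
  obtain t v where t: "t \<in> S" and v: "v \<in> lists (S \<times> UNIV)"
    and y: "y = word_act FQ star \<phi> (\<phi> t) v"
    using free_quandle_generated[OF assms xy(2)] .
  define x' where "x' = word_act FQ star \<phi> x (word_inv v)"
  have v': "word_inv v \<in> lists (S \<times> UNIV)" using v by (rule word_inv_in_lists)
  have \<phi>t: "\<phi> t \<in> FQ" using \<phi> t by auto
  have y': "word_act FQ star \<phi> y (word_inv v) = \<phi> t"
    unfolding y by (rule word_act_inv[OF \<phi> \<phi>t v])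
  have x': "x' \<in> FQ" unfolding x'_def by (rule word_act_closed[OF \<phi> xy(1) v'])
  have "x' \<noteq> \<phi> t" using word_act_inj[OF \<phi> xy(1,2) v'] xy(3) y' by (auto simp: x'_def)
  obtain s w0 where s: "s \<in> S" and w0: "w0 \<in> lists (S \<times> UNIV)" "x' = word_act FQ star \<phi> (\<phi> s) w0"
    using free_quandle_generated[OF assms x'] .
  then obtain w where w: "w \<in> lists (S \<times> UNIV)" "x' = word_act FQ star \<phi> (\<phi> s) w"
    and shortest: "\<And>v. \<lbrakk>v \<in> lists (S \<times> UNIV); x' = word_act FQ star \<phi> (\<phi> s) v\<rbrakk> \<Longrightarrow> length w \<le> length v"
    using ex_has_least_nat[of "\<lambda>w. w \<in> lists (S \<times> UNIV) \<and> x' = word_act FQ star \<phi> (\<phi> s) w" w0 length]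
    by blast
  have "reduced (word_inv w @ (s, True) # w)"
    using shortest_word_reduced[OF \<phi> s w(1)] shortest w(2) by simp
  moreover have "s \<noteq> t" if "w = []" using that w(2) \<open>x' \<noteq> \<phi> t\<close> by auto
  ultimately obtain n P where P: "\<forall>a. P a permutes {..n::nat}"
    and sep: "word_act {p. p permutes {..n}} perm_conj P (P s) w \<noteq> P t"
    by (rule separating_permutations)
  let ?F = "{p. p permutes {..n}}"
  have F: "quandle ?F perm_conj" by (rule quandle_perm_conj)
  have "P \<in> S \<rightarrow> ?F" using P by auto
  \<comment> \<open>The elements of \<open>?F\<close> are functions, so the universal property is
    taken in the form for an arbitrary element type.\<close>
  then obtain \<psi> where \<psi>: "\<psi> \<in> quandle_hom FQ star ?F perm_conj" "\<forall>s\<in>S. \<psi> (\<phi> s) = P s"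
    using free_quandle_universal[OF assms, where ?'c = "nat \<Rightarrow> nat"] F
    unfolding free_quandle_wrt_def by blast
  note \<psi>_act = hom_word_act[OF Q F \<psi>(1) \<phi> \<psi>(2)]
  have "\<psi> x' = word_act ?F perm_conj P (P s) w"
    using \<psi>_act[of "\<phi> s" w] w \<phi> s \<psi>(2) by auto
  then have "\<psi> x' \<noteq> \<psi> (\<phi> t)" using sep \<psi>(2) t by simp
  \<comment> \<open>\<open>\<psi>\<close> commutes with the action of \<open>word_inv v\<close>, so
    equal images of \<open>x\<close> and \<open>y\<close> would give equal images of
    \<open>x'\<close> and \<open>\<phi> t\<close>.\<close>
  then have "\<psi> x \<noteq> \<psi> y"
    using \<psi>_act[OF xy(1) v'] \<psi>_act[OF xy(2) v'] y' by (auto simp: x'_def)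
  moreover have "finite ?F" by (simp add: finite_permutations)
  ultimately show "\<exists>(F :: (nat \<Rightarrow> nat) set) g \<psi>. quandle F g \<and> finite F \<and>
      \<psi> \<in> quandle_hom FQ star F g \<and> \<psi> x \<noteq> \<psi> y"
    using F \<psi>(1) by blast
qed

end
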